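(* For every integer $n\ge 0$, $$F_{n+1}(x)=x\sum_{k=0}^{n}\binom{n}{k}\left[F_{k}(x)+xF_{k}'(x)\right],$$ where $F_k'(x)$ denotes the first derivative of the geometric polynomial $F_k(x)$ with respect to $x$.
   Context: For integers $n,k\ge 0$, ${n\brace k}$ denotes the Stirling number of the second kind, defined by $\sum_{n=0}^{\infty}{n\brace k}\frac{x^n}{n!}=\frac{(e^x-1)^k}{k!}$. The $n$-th geometric (Fubini) polynomial is $F_n(x)=\sum_{k=0}^{n}{n\brace k}k!\,x^k$ (so $F_0(x)=1$, $F_1(x)=x$, $F_2(x)=x+2x^2$). *)

theory Defs
  imports
    "HOL-Combinatorics.Stirling"
    "HOL-Computational_Algebra.Computational_Algebra"
begin

text \<open>
  The library's \<^const>\<open>Stirling\<close> is given by its triangular recurrence. The theorem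
  \<open>Stirling_egf\<close> below shows that it has the exponential generating function
  $(e^x-1)^k/k!$, which characterises the Stirling numbers of the second kind.
\<close>

lemma fps_nth_exp_minus_one_power:
  "fps_nth (fps_const (1 / fact k) * (fps_exp 1 - 1) ^ k :: 'a::field_char_0 fps) n
     = of_nat (Stirling n k) / fact n"
proof (induction n arbitrary: k)
  case 0
  show ?case by (cases k) (simp_all add: fps_nth_power_0)
next
  case (Suc n)
  define B :: "nat \<Rightarrow> 'a fps" where "B = (\<lambda>k. fps_const (1 / fact k) * (fps_exp 1 - 1) ^ k)"
  have IH: "fps_nth (B k) n = of_nat (Stirling n k) / fact n" for k
    using Suc.IH by (simp add: B_def)
  show ?case
  proof (cases k)
    case 0
    then show ?thesis by simp
  next
    case (Suc m)
    have c: "fps_const (1 / fact (Suc m)) * of_nat (Suc m) = fps_const (1 / fact m :: 'a)"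
      by (simp add: fps_of_nat [symmetric] del: of_nat_Suc)
    have "fps_deriv (B (Suc m))
        = (fps_const (1 / fact (Suc m)) * of_nat (Suc m)) * ((fps_exp 1 - 1) ^ m * fps_exp 1)"
      by (simp add: B_def fps_deriv_power mult_ac fps_of_nat [symmetric] del: of_nat_Suc fact_Suc power_Suc)
    also have "\<dots> = fps_const (1 / fact m) * (fps_exp 1 - 1) ^ m * (1 + (fps_exp 1 - 1))"
      by (simp only: c) (simp add: mult_ac)
    also have "\<dots> = B m + fps_const (1 / fact m) * (fps_exp 1 - 1) ^ Suc m"
      by (simp add: B_def algebra_simps)
    also have "\<dots> = B m + of_nat (Suc m) * B (Suc m)"
      unfolding c [symmetric] by (simp add: B_def mult_ac del: of_nat_Suc fact_Suc)
    finally have "fps_nth (fps_deriv (B (Suc m))) n = fps_nth (B m + of_nat (Suc m) * B (Suc m)) n"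
      by simp
    then have "of_nat (Suc n) * fps_nth (B (Suc m)) (Suc n)
        = of_nat (Stirling (Suc n) (Suc m)) / (fact n :: 'a)"
      by (simp add: IH fps_of_nat [symmetric] field_simps)
    then have "fps_nth (B (Suc m)) (Suc n) = of_nat (Stirling (Suc n) (Suc m)) / fact (Suc n)"
      by (simp add: field_simps del: of_nat_Suc Stirling.simps)
    then show ?thesis using Suc by (simp only: B_def)
  qed
qed

theorem Stirling_egf:
  "Abs_fps (\<lambda>n. of_nat (Stirling n k) / fact n)
     = fps_const (1 / fact k) * (fps_exp 1 - 1 :: 'a::field_char_0 fps) ^ k"
  by (rule fps_ext) (simp only: fps_nth_Abs_fps fps_nth_exp_minus_one_power)

definition geometric_poly :: "nat \<Rightarrow> 'a::field_char_0 poly" where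
  "geometric_poly n = (\<Sum>k\<le>n. monom (of_nat (Stirling n k) * fact k) k)"

lemma geometric_poly_examples:
  "geometric_poly 0 = 1"
  "geometric_poly 1 = [:0, 1:]"
  "geometric_poly 2 = [:0, 1, 2:]"
  by (simp_all add: geometric_poly_def monom_altdef atMost_Suc numeral_2_eq_2)

end

theory Submission
  imports Defs
begin

text \<open>
  Comparing coefficients of $x^{j+1}$ reduces the identity to
  ${n+1\brace j+1} = \sum_k \binom{n}{k}{k\brace j}$, which is the coefficient form of
  $\frac{d}{dx}\frac{(e^x-1)^{j+1}}{(j+1)!} = \frac{(e^x-1)^j}{j!}\,e^x$.
\<close>

lemma Stirling_Suc_Suc_eq_sum:
  "Stirling (Suc n) (Suc j) = (\<Sum>k\<le>n. (n choose k) * Stirling k j)"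
proof -
  \<comment> \<open>\<open>B k\<close> is the exponential generating function of
    \<open>Stirling m k\<close> in \<open>m\<close>; over \<open>rat\<close>, the injectivity of
    \<open>of_nat\<close> brings the result back to naturals.\<close>
  define B :: "nat \<Rightarrow> rat fps" where "B k = fps_const (1 / fact k) * (fps_exp 1 - 1) ^ k" for k
  have B_nth: "fps_nth (B k) m = of_nat (Stirling m k) / fact m" for k m
    unfolding B_def by (rule fps_nth_exp_minus_one_power)
  have c: "fps_const (1 / fact (Suc j)) * of_nat (Suc j) = (fps_const (1 / fact j) :: rat fps)"
    by (simp add: fps_of_nat [symmetric] del: of_nat_Suc)
  have "fps_deriv (B (Suc j))
      = (fps_const (1 / fact (Suc j)) * of_nat (Suc j)) * ((fps_exp 1 - 1) ^ j * fps_exp 1)"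
    by (simp add: B_def fps_deriv_power mult_ac fps_of_nat [symmetric]
        del: of_nat_Suc fact_Suc power_Suc)
  then have deriv: "fps_deriv (B (Suc j)) = B j * fps_exp 1"
    by (simp only: c B_def mult.assoc)
  \<comment> \<open>Differentiation shifts the index: the factor \<open>Suc n\<close> turns the
    denominator \<open>fact (Suc n)\<close> into \<open>fact n\<close>.\<close>
  have "of_nat (Stirling (Suc n) (Suc j)) = fact n * fps_nth (fps_deriv (B (Suc j))) n"
    by (simp add: B_nth del: Stirling.simps of_nat_Suc)
  also have "\<dots> = (\<Sum>k\<le>n. fact n * (of_nat (Stirling k j) / fact k * (1 / fact (n - k))))"
    unfolding deriv by (simp add: fps_mult_nth B_nth sum_distrib_left atLeast0AtMost)
  also have "\<dots> = (\<Sum>k\<le>n. of_nat (n choose k) * of_nat (Stirling k j))"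
    by (intro sum.cong refl) (simp add: binomial_fact)
  also have "\<dots> = of_nat (\<Sum>k\<le>n. (n choose k) * Stirling k j)"
    by simp
  finally show ?thesis
    by (simp only: of_nat_eq_iff)
qed

text \<open>No bound on \<open>j\<close> is required, since \<open>Stirling n j\<close> vanishes for
  \<open>j > n\<close>.\<close>

lemma coeff_geometric_poly:
  "coeff (geometric_poly n) j = of_nat (Stirling n j) * fact j"
  by (simp add: geometric_poly_def coeff_sum)

theorem proposition12:
  fixes n :: nat
  shows "(geometric_poly (n + 1) :: 'a::field_char_0 poly)
    = [:0, 1:] * (\<Sum>k=0..n. of_nat (n choose k)
        * (geometric_poly k + [:0, 1:] * pderiv (geometric_poly k)))"
proof (rule poly_eqI)
  fix i
  \<comment> \<open>F + x F' is the derivative of x F, so it scales the coefficient of degree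
    \<open>j\<close> by \<open>j + 1\<close>, which raises \<open>fact j\<close> to
    \<open>fact (Suc j)\<close>.\<close>
  have summand: "coeff (geometric_poly k + [:0, 1:] * pderiv (geometric_poly k)) j
      = of_nat (Stirling k j) * (fact (Suc j) :: 'a)" for k j
    by (cases j) (simp_all add: coeff_geometric_poly coeff_pderiv algebra_simps)
  have coeff_of_nat_mult: "coeff (of_nat m * p) j = of_nat m * coeff p j" for m j and p :: "'a poly"
    by (simp add: of_nat_poly)
  show "coeff (geometric_poly (n + 1) :: 'a poly) i
    = coeff ([:0, 1:] * (\<Sum>k=0..n. of_nat (n choose k)
        * (geometric_poly k + [:0, 1:] * pderiv (geometric_poly k)))) i"
  proof (cases i)
    case 0
    then show ?thesis
      by (simp add: coeff_geometric_poly)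
  next
    case (Suc j)
    \<comment> \<open>The outer factor x shifts degree \<open>j\<close> to \<open>Suc j\<close>.
      Both sides then carry the same \<open>fact (Suc j)\<close>, leaving only the Stirling
      identity.\<close>
    have "coeff (geometric_poly (n + 1) :: 'a poly) i
        = (\<Sum>k=0..n. of_nat (n choose k) * (of_nat (Stirling k j) * fact (Suc j)))"
      by (simp add: Suc coeff_geometric_poly Stirling_Suc_Suc_eq_sum sum_distrib_right
          atLeast0AtMost mult.assoc del: Stirling.simps fact_Suc)
    also have "\<dots> = coeff (\<Sum>k=0..n. of_nat (n choose k)
        * (geometric_poly k + [:0, 1:] * pderiv (geometric_poly k))) j"
      by (simp only: coeff_sum coeff_of_nat_mult summand)
    finally show ?thesis
      by (simp add: Suc)
  qed
qed

end
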